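(* Consider the Nicholson equation $$x'(t)=\beta(t)\Big(\sum_{j=1}^m p_j\,x(t-\tau_j(t))\,e^{-a_j x(t-\sigma_j(t))}-\delta x(t)\Big),\qquad t\ge t_0,$$ where $m\ge 1$, $p_j,a_j,\delta\in(0,\infty)$, and $\beta,\sigma_j,\tau_j:[t_0,\infty)\to[0,\infty)$ are continuous and bounded ($1\le j\le m$) with $\inf_{t\ge t_0}\beta(t)>0$. Let $p=\sum_{j=1}^m p_j$, assume $p>\delta$, and let $K>0$ be the unique positive solution of $\sum_{j=1}^m p_je^{-a_jK}=\delta$. If $$\limsup_{t\to+\infty}\sum_{j=1}^m a_jp_je^{-a_jK}\int_{t-\sigma_j(t)}^t\beta(s)\,ds<\frac{\sum_{j=1}^m a_jp_je^{-a_jK}}{2\delta+K\sum_{j=1}^m a_jp_je^{-a_jK}},$$ then the equilibrium $K$ is locally exponentially stable for the equation.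
   Context: Let $\tau=\max\{\sup_{t\ge t_0}\tau_j(t),\ \sup_{t\ge t_0}\sigma_j(t): 1\le j\le m\}$. The phase space is $C=C([-\tau,0];\mathbb{R})$ with the supremum norm $\|\cdot\|$. The set of admissible initial conditions is $C_0^+=\{\phi\in C:\phi(\theta)\ge 0 \text{ for }\theta\in[-\tau,0),\ \phi(0)>0\}$, and $x(t;t_0,\phi)$ denotes the solution with $x(t_0+\theta)=\phi(\theta)$ for $\theta\in[-\tau,0]$; such solutions are defined and positive on $[t_0,\infty)$. Stability notions refer to solutions with initial conditions in $C_0^+$. Local exponential stability of $K$ means: there are $\rho,M,\gamma>0$ such that $|x(t;t_0,\phi)-K|\le M e^{-\gamma(t-t_0)}\|\phi-K\|$ for all $t\ge t_0$ and all $\phi\in C_0^+$ with $\|\phi-K\|<\rho$ (here $K$ also denotes the constant function). *)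

theory Defs
  imports "HOL-Analysis.Analysis"
begin

definition max_delay :: "real \<Rightarrow> nat \<Rightarrow> (nat \<Rightarrow> real \<Rightarrow> real) \<Rightarrow> (nat \<Rightarrow> real \<Rightarrow> real) \<Rightarrow> real" where
  "max_delay t0 m \<tau> \<sigma> =
     Max ((\<lambda>j. max (SUP t\<in>{t0..}. \<tau> j t) (SUP t\<in>{t0..}. \<sigma> j t)) ` {1..m})"

text \<open>An element of \<open>C([-r,0];\<real>)\<close> is represented by a total function that is continuous on
  \<open>{-r..0}\<close>; its values elsewhere are never used.\<close>

definition phase_space :: "real \<Rightarrow> (real \<Rightarrow> real) set" where
  "phase_space r = {\<phi>. continuous_on {-r..0} \<phi>}"

definition phase_norm :: "real \<Rightarrow> (real \<Rightarrow> real) \<Rightarrow> real" where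
  "phase_norm r \<phi> = (SUP \<theta>\<in>{-r..0}. \<bar>\<phi> \<theta>\<bar>)"

definition admissible :: "real \<Rightarrow> (real \<Rightarrow> real) set" where
  "admissible r = {\<phi> \<in> phase_space r. (\<forall>\<theta>\<in>{-r..<0}. 0 \<le> \<phi> \<theta>) \<and> 0 < \<phi> 0}"

text \<open>The derivative at \<open>t0\<close> is the right-hand one, and \<open>r\<close> is the length of the history interval.
  For an admissible \<open>\<phi>\<close> and \<open>r\<close> the maximal delay there is exactly one solution up to its
  (irrelevant) values below \<open>t0 - r\<close>; it is the function written \<open>x(t; t0, \<phi>)\<close>.\<close>

definition nicholson_solution ::
  "real \<Rightarrow> real \<Rightarrow> nat \<Rightarrow> (nat \<Rightarrow> real) \<Rightarrow> (nat \<Rightarrow> real) \<Rightarrow> real \<Rightarrow> (real \<Rightarrow> real) \<Rightarrow>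
   (nat \<Rightarrow> real \<Rightarrow> real) \<Rightarrow> (nat \<Rightarrow> real \<Rightarrow> real) \<Rightarrow> (real \<Rightarrow> real) \<Rightarrow> (real \<Rightarrow> real) \<Rightarrow> bool" where
  "nicholson_solution t0 r m p a \<delta> \<beta> \<tau> \<sigma> \<phi> x \<longleftrightarrow>
     (\<forall>\<theta>\<in>{-r..0}. x (t0 + \<theta>) = \<phi> \<theta>) \<and>
     (\<forall>t\<ge>t0. (x has_real_derivative
        \<beta> t * ((\<Sum>j=1..m. p j * x (t - \<tau> j t) * exp (- a j * x (t - \<sigma> j t))) - \<delta> * x t))
        (at t within {t0..}))"

text \<open>\<open>sol \<phi> x\<close> says that \<open>x\<close> is a solution with initial function \<open>\<phi>\<close> at \<open>t0\<close>.\<close>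

definition locally_exp_stable ::
  "real \<Rightarrow> real \<Rightarrow> ((real \<Rightarrow> real) \<Rightarrow> (real \<Rightarrow> real) \<Rightarrow> bool) \<Rightarrow> real \<Rightarrow> bool" where
  "locally_exp_stable t0 r sol K \<longleftrightarrow>
     (\<exists>\<rho>>0. \<exists>M>0. \<exists>\<gamma>>0. \<forall>\<phi>\<in>admissible r. phase_norm r (\<lambda>\<theta>. \<phi> \<theta> - K) < \<rho> \<longrightarrow>
        (\<forall>x. sol \<phi> x \<longrightarrow>
          (\<forall>t\<ge>t0. \<bar>x t - K\<bar> \<le> M * exp (- \<gamma> * (t - t0)) * phase_norm r (\<lambda>\<theta>. \<phi> \<theta> - K))))"

end

theory Submission
  imports Defs
begin

text \<open>With \<open>y = x - K\<close>, \<open>w\<^sub>j = p\<^sub>j exp (- a\<^sub>j K)\<close> and \<open>A = \<Sum> a\<^sub>j w\<^sub>j\<close>, the equation reads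
  \<open>y' = \<beta> (- (\<delta> + K A) y + \<Sum> w\<^sub>j y(t - \<tau>\<^sub>j) + K \<Sum> a\<^sub>j w\<^sub>j (y - y(t - \<sigma>\<^sub>j)) + o(|y|))\<close>.
  Integrating the crude bound \<open>|y'| \<le> \<beta> (2 \<delta> + K A + o(1)) sup |y|\<close> over \<open>{t - \<sigma>\<^sub>j..t}\<close> estimates the
  third term, and the \<open>Limsup\<close> hypothesis says exactly that the instantaneous term
  \<open>(\<delta> + K A) y\<close> then strictly dominates the others. Hence \<open>|y|\<close> cannot be the first to reach a
  slowly decaying exponential. On the initial interval, where the \<open>Limsup\<close> hypothesis gives
  nothing, \<open>|y|\<close> is compared with a growing exponential instead.\<close>

section \<open>Comparison of a function with a positive barrier\<close>

text \<open>First-contact argument for \<open>V\<^sup>2 - y\<^sup>2\<close>; squaring avoids the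
  kink of the absolute value and treats both signs of \<open>y\<close> at once. At a first contact
  the \<open>touch\<close> hypothesis makes the derivative of this difference positive, so the
  difference was already negative just before. \<open>touch\<close> may use the bound on all of
  \<open>{T..t}\<close>, which is what a delay equation needs.\<close>

lemma abs_less_by_derivative_comparison:
  fixes y V :: "real \<Rightarrow> real"
  assumes dy: "\<And>t. t \<in> {T..S} \<Longrightarrow> (y has_real_derivative y' t) (at t within {T..S})"
    and dV: "\<And>t. t \<in> {T..S} \<Longrightarrow> (V has_real_derivative V' t) (at t within {T..S})"
    and pos: "\<And>t. t \<in> {T..S} \<Longrightarrow> 0 < V t"
    and start: "\<bar>y T\<bar> < V T"
    and touch: "\<And>t. \<lbrakk>t \<in> {T..S}; \<forall>s\<in>{T..t}. \<bar>y s\<bar> \<le> V s; \<bar>y t\<bar> = V t\<rbrakk> \<Longrightarrow> y t * y' t < V t * V' t"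
    and t: "t \<in> {T..S}"
  shows "\<bar>y t\<bar> < V t"
proof (rule ccontr)
  define g where "g = (\<lambda>t. (V t)\<^sup>2 - (y t)\<^sup>2)"
  have g_pos: "0 < g s \<longleftrightarrow> \<bar>y s\<bar> < V s" if "s \<in> {T..S}" for s
    using pos[OF that] abs_le_square_iff[of "V s" "y s"] unfolding g_def by auto
  have dg: "(g has_real_derivative 2 * (V s * V' s - y s * y' s)) (at s within {T..S})"
    if "s \<in> {T..S}" for s
    unfolding g_def
    by (rule derivative_eq_intros dy dV that | simp add: algebra_simps)+
  have cont: "continuous_on {T..S} g"
    using dg by (meson DERIV_continuous continuous_on_eq_continuous_within)
  assume "\<not> \<bar>y t\<bar> < V t"
  then have gt: "g t \<le> 0" using g_pos[OF t] by simp
  define Z where "Z = {s \<in> {T..S}. g s \<le> 0}"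
  define u where "u = Inf Z"
  have "t \<in> Z" using t gt by (simp add: Z_def)
  have bdd: "bdd_below Z" by (auto simp: Z_def intro: bdd_belowI[of _ T])
  have "closed Z"
    unfolding Z_def using cont by (intro continuous_on_closed_Collect_le continuous_intros) auto
  then have "u \<in> Z"
    unfolding u_def using closed_contains_Inf[of Z] bdd \<open>t \<in> Z\<close> by blast
  then have u: "u \<in> {T..S}" "g u \<le> 0" by (auto simp: Z_def)
  have before: "0 < g s" if "s \<in> {T..<u}" for s
  proof (rule ccontr)
    assume "\<not> 0 < g s"
    then have "s \<in> Z" using that u by (auto simp: Z_def)
    then have "u \<le> s" unfolding u_def by (rule cInf_lower[OF _ bdd])
    then show False using that by simp
  qed
  have "T < u" using start g_pos[of T] u by (cases "u = T") auto
  \<comment> \<open>Membership in \<open>Z\<close> gives only \<open>g u \<le> 0\<close>; a negative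
    value would force an earlier zero by the intermediate value theorem. Equality is what
    \<open>touch\<close> requires.\<close>
  have "g u = 0"
  proof (rule ccontr)
    assume "g u \<noteq> 0"
    then have "g u < 0" using u by simp
    moreover have "0 < g T" using before[of T] \<open>T < u\<close> by simp
    moreover have "continuous_on {T..u} g" using cont u by (auto elim: continuous_on_subset)
    ultimately obtain c where "T \<le> c" "c \<le> u" "g c = 0"
      using IVT2'[of g u 0 T] \<open>T < u\<close> by auto
    then show False using before[of c] \<open>g u < 0\<close> by (cases "c = u") auto
  qed
  have le: "\<bar>y s\<bar> \<le> V s" if "s \<in> {T..<u}" for s
    using g_pos[of s] before[OF that] that u by auto
  have eq: "\<bar>y u\<bar> = V u"
    using \<open>g u = 0\<close> pos[OF u(1)] unfolding g_def by (auto simp: power2_eq_iff)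
  have "\<forall>s\<in>{T..u}. \<bar>y s\<bar> \<le> V s"
  proof
    fix s assume "s \<in> {T..u}"
    then show "\<bar>y s\<bar> \<le> V s" using le[of s] eq by (cases "s = u") auto
  qed
  from touch[OF u(1) this eq] have "0 < 2 * (V u * V' u - y u * y' u)" by simp
  from has_real_derivative_pos_inc_left[OF dg[OF u(1)] this] obtain d where
    d: "0 < d" "\<And>h. \<lbrakk>0 < h; u - h \<in> {T..S}; h < d\<rbrakk> \<Longrightarrow> g (u - h) < g u"
    by blast
  \<comment> \<open>The step back stays in \<open>{T..<u}\<close>, where \<open>g\<close> is known
    to be positive, and below the radius \<open>d\<close> on which \<open>g\<close> increases up to
    \<open>u\<close>.\<close>
  define h where "h = min (d / 2) (u - T)"
  have "0 < h" "h < d" "u - h \<in> {T..<u}" "u - h \<in> {T..S}"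
    using d(1) \<open>T < u\<close> u by (auto simp: h_def min_def)
  then show False using d(2)[of h] before[of "u - h"] \<open>g u = 0\<close> by force
qed

section \<open>Linearization at the equilibrium\<close>

text \<open>The two estimates control the two nonlinear terms of the expansion at \<open>K\<close>:
  the first is multiplied by a deviation, the second by the constant \<open>K\<close>, so only the
  second must itself be small relative to \<open>v\<close>.\<close>

lemma exp_first_order_eventually:
  fixes a e :: real
  assumes "0 < e"
  shows "\<forall>\<^sub>F v in nhds 0. \<bar>exp (- a * v) - 1\<bar> \<le> e \<and> \<bar>exp (- a * v) - 1 + a * v\<bar> \<le> e * \<bar>v\<bar>"
proof (rule eventually_conj)
  have "((\<lambda>v. exp (- a * v)) has_derivative (\<lambda>v. - a * v)) (at 0)"
    by (auto intro!: derivative_eq_intros)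
  then obtain d where "0 < d"
    and d: "\<And>v. \<bar>v\<bar> < d \<Longrightarrow> \<bar>exp (- a * v) - 1 + a * v\<bar> \<le> e * \<bar>v\<bar>"
    using assms unfolding has_derivative_at_alt by fastforce
  then show "\<forall>\<^sub>F v in nhds 0. \<bar>exp (- a * v) - 1 + a * v\<bar> \<le> e * \<bar>v\<bar>"
    unfolding eventually_nhds_metric by (auto simp: dist_real_def)
  have "((\<lambda>v. \<bar>exp (- a * v) - 1\<bar>) \<longlongrightarrow> \<bar>exp (- a * 0) - 1\<bar>) (nhds 0)"
    by (intro tendsto_intros filterlim_ident)
  then have "((\<lambda>v. \<bar>exp (- a * v) - 1\<bar>) \<longlongrightarrow> 0) (nhds 0)" by simp
  from order_tendstoD(2)[OF this assms]
  show "\<forall>\<^sub>F v in nhds 0. \<bar>exp (- a * v) - 1\<bar> \<le> e"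
    by eventually_elim simp
qed

text \<open>Here \<open>r\<close> is any common upper bound of the delays. Quantitative bounds for
  \<open>\<beta>\<close> enter only in the lemmas that use them, as \<open>b\<close> and
  \<open>B\<close>.\<close>

locale nicholson_equilibrium =
  fixes t0 r \<delta> K :: real and m :: nat
    and p a :: "nat \<Rightarrow> real"
    and \<beta> :: "real \<Rightarrow> real"
    and \<tau> \<sigma> :: "nat \<Rightarrow> real \<Rightarrow> real"
  assumes \<delta>_pos: "0 < \<delta>"
    and K_pos: "0 < K"
    and p_pos: "\<And>j. j \<in> {1..m} \<Longrightarrow> 0 < p j"
    and a_pos: "\<And>j. j \<in> {1..m} \<Longrightarrow> 0 < a j"
    and r_nonneg: "0 \<le> r"
    and \<beta>_cont: "continuous_on {t0..} \<beta>"
    and \<beta>_nonneg: "\<And>t. t0 \<le> t \<Longrightarrow> 0 \<le> \<beta> t"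
    and \<tau>_range: "\<And>j t. \<lbrakk>j \<in> {1..m}; t0 \<le> t\<rbrakk> \<Longrightarrow> \<tau> j t \<in> {0..r}"
    and \<sigma>_range: "\<And>j t. \<lbrakk>j \<in> {1..m}; t0 \<le> t\<rbrakk> \<Longrightarrow> \<sigma> j t \<in> {0..r}"
    and equilibrium: "(\<Sum>j=1..m. p j * exp (- a j * K)) = \<delta>"
begin

definition w :: "nat \<Rightarrow> real" where "w j = p j * exp (- a j * K)"

definition A :: real where "A = (\<Sum>j=1..m. a j * w j)"

text \<open>The factor \<open>\<beta>\<close> stays outside, so that integrating a bound on
  \<open>rhs\<close> produces the integrals of \<open>\<beta>\<close> that occur in the
  hypothesis.\<close>

definition rhs :: "(real \<Rightarrow> real) \<Rightarrow> real \<Rightarrow> real" where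
  "rhs x t = (\<Sum>j=1..m. p j * x (t - \<tau> j t) * exp (- a j * x (t - \<sigma> j t))) - \<delta> * x t"

lemma w_pos: "j \<in> {1..m} \<Longrightarrow> 0 < w j"
  using p_pos by (simp add: w_def)

lemma sum_w: "(\<Sum>j=1..m. w j) = \<delta>"
  using equilibrium by (simp add: w_def)

lemma A_nonneg: "0 \<le> A"
  unfolding A_def using w_pos a_pos by (intro sum_nonneg) (simp add: less_imp_le)

text \<open>An exact identity: \<open>exp (- a j * K)\<close> is absorbed into \<open>w j\<close>,
  and the first-order part in the deviations is separated from the rest. The leftover constants
  \<open>K * w j\<close> add up to \<open>K * \<delta>\<close> and turn
  \<open>\<delta> * x t\<close> into \<open>\<delta> * (x t - K)\<close>.\<close>

lemma rhs_expand:
  "rhs x t = (\<Sum>j=1..m. w j * ((x (t - \<tau> j t) - K) * (exp (- a j * (x (t - \<sigma> j t) - K)) - 1)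
        + K * (exp (- a j * (x (t - \<sigma> j t) - K)) - 1 + a j * (x (t - \<sigma> j t) - K))))
      + (\<Sum>j=1..m. w j * (x (t - \<tau> j t) - K))
      - K * (\<Sum>j=1..m. a j * w j * (x (t - \<sigma> j t) - K)) - \<delta> * (x t - K)"
proof -
  have "p j * x (t - \<tau> j t) * exp (- a j * x (t - \<sigma> j t))
      = w j * ((x (t - \<tau> j t) - K) * (exp (- a j * (x (t - \<sigma> j t) - K)) - 1)
        + K * (exp (- a j * (x (t - \<sigma> j t) - K)) - 1 + a j * (x (t - \<sigma> j t) - K)))
      + w j * (x (t - \<tau> j t) - K) - K * (a j * w j * (x (t - \<sigma> j t) - K)) + K * w j" for j
  proof -
    have "exp (- a j * x (t - \<sigma> j t)) = exp (- a j * K) * exp (- a j * (x (t - \<sigma> j t) - K))"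
      by (simp add: exp_add[symmetric] algebra_simps)
    then show ?thesis unfolding w_def by (simp add: algebra_simps)
  qed
  then have "(\<Sum>j=1..m. p j * x (t - \<tau> j t) * exp (- a j * x (t - \<sigma> j t)))
      = (\<Sum>j=1..m. w j * ((x (t - \<tau> j t) - K) * (exp (- a j * (x (t - \<sigma> j t) - K)) - 1)
        + K * (exp (- a j * (x (t - \<sigma> j t) - K)) - 1 + a j * (x (t - \<sigma> j t) - K))))
      + (\<Sum>j=1..m. w j * (x (t - \<tau> j t) - K))
      - K * (\<Sum>j=1..m. a j * w j * (x (t - \<sigma> j t) - K)) + K * (\<Sum>j=1..m. w j)"
    by (simp only: sum.distrib sum_subtractf sum_distrib_left)
  then show ?thesis unfolding rhs_def sum_w by (simp only: right_diff_distrib mult.commute)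
qed

text \<open>Smallness (\<open>\<eta>\<close>) and scale (\<open>U\<close>) are separate: once the
  deviation is below \<open>\<eta>\<close>, the remainder is linear in the actual bound
  \<open>U\<close>. The function \<open>x\<close> is arbitrary, so one \<open>\<eta>\<close> serves
  all solutions.\<close>

definition linearization_radius :: "real \<Rightarrow> real \<Rightarrow> bool" where
  "linearization_radius h \<eta> \<longleftrightarrow> (\<forall>x t U. t0 \<le> t \<longrightarrow>
      (\<forall>s\<in>{t - r..t}. \<bar>x s - K\<bar> \<le> U \<and> \<bar>x s - K\<bar> < \<eta>) \<longrightarrow>
      \<bar>rhs x t - ((\<Sum>j=1..m. w j * (x (t - \<tau> j t) - K))
        - K * (\<Sum>j=1..m. a j * w j * (x (t - \<sigma> j t) - K)) - \<delta> * (x t - K))\<bar> \<le> h * U)"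

lemma small_remainder:
  assumes "0 < h"
  obtains \<eta> where "0 < \<eta>" "linearization_radius h \<eta>"
proof -
  \<comment> \<open>Each remainder costs at most \<open>e * (1 + K) * U\<close> and the weights
    \<open>w j\<close> sum to \<open>\<delta>\<close>; this \<open>e\<close> makes the total
    \<open>h * U\<close>.\<close>
  define e where "e = h / (\<delta> * (1 + K))"
  have "0 < e" using assms \<delta>_pos K_pos by (simp add: e_def)
  have "\<forall>\<^sub>F v in nhds 0. \<forall>j\<in>{1..m}.
      \<bar>exp (- a j * v) - 1\<bar> \<le> e \<and> \<bar>exp (- a j * v) - 1 + a j * v\<bar> \<le> e * \<bar>v\<bar>"
    by (intro eventually_ball_finite ballI exp_first_order_eventually \<open>0 < e\<close>) simp
  then obtain \<eta> where "0 < \<eta>" and \<eta>: "\<And>v j. \<lbrakk>\<bar>v\<bar> < \<eta>; j \<in> {1..m}\<rbrakk> \<Longrightarrow>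
      \<bar>exp (- a j * v) - 1\<bar> \<le> e \<and> \<bar>exp (- a j * v) - 1 + a j * v\<bar> \<le> e * \<bar>v\<bar>"
    unfolding eventually_nhds_metric by (auto simp: dist_real_def)
  show thesis
  proof (rule that[OF \<open>0 < \<eta>\<close>], unfold linearization_radius_def, intro allI impI)
    fix x t U
    assume t: "t0 \<le> t" and U: "\<forall>s\<in>{t - r..t}. \<bar>x s - K\<bar> \<le> U \<and> \<bar>x s - K\<bar> < \<eta>"
    define R where "R j = (x (t - \<tau> j t) - K) * (exp (- a j * (x (t - \<sigma> j t) - K)) - 1)
        + K * (exp (- a j * (x (t - \<sigma> j t) - K)) - 1 + a j * (x (t - \<sigma> j t) - K))" for j
    have R: "\<bar>R j\<bar> \<le> e * (1 + K) * U" if j: "j \<in> {1..m}" for j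
    proof -
      let ?u = "x (t - \<tau> j t) - K" and ?v = "x (t - \<sigma> j t) - K"
      have u: "\<bar>?u\<bar> \<le> U" and v: "\<bar>?v\<bar> \<le> U" "\<bar>?v\<bar> < \<eta>"
        using U \<tau>_range[OF j t] \<sigma>_range[OF j t] by auto
      have "\<bar>?u * (exp (- a j * ?v) - 1)\<bar> \<le> U * e"
        unfolding abs_mult using \<eta>[OF v(2) j] u by (intro mult_mono) auto
      moreover have "\<bar>K * (exp (- a j * ?v) - 1 + a j * ?v)\<bar> \<le> K * (e * U)"
      proof -
        have "e * \<bar>?v\<bar> \<le> e * U" using v \<open>0 < e\<close> by simp
        then have "\<bar>exp (- a j * ?v) - 1 + a j * ?v\<bar> \<le> e * U" using \<eta>[OF v(2) j] by linarith
        then show ?thesis unfolding abs_mult using K_pos by simp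
      qed
      ultimately show ?thesis unfolding R_def by (simp add: algebra_simps abs_le_iff)
    qed
    have "\<bar>\<Sum>j=1..m. w j * R j\<bar> \<le> (\<Sum>j=1..m. w j * (e * (1 + K) * U))"
    proof (rule order_trans[OF sum_abs], rule sum_mono)
      fix j assume j: "j \<in> {1..m}"
      then show "\<bar>w j * R j\<bar> \<le> w j * (e * (1 + K) * U)"
        unfolding abs_mult using R[OF j] w_pos[OF j] by simp
    qed
    also have "\<dots> = \<delta> * (e * (1 + K) * U)" by (simp only: sum_distrib_right[symmetric] sum_w)
    also have "\<dots> = h * U" using \<delta>_pos K_pos by (simp add: e_def)
    finally show "\<bar>rhs x t - ((\<Sum>j=1..m. w j * (x (t - \<tau> j t) - K))
            - K * (\<Sum>j=1..m. a j * w j * (x (t - \<sigma> j t) - K)) - \<delta> * (x t - K))\<bar> \<le> h * U"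
      unfolding rhs_expand[of x t] R_def by simp
  qed
qed

section \<open>Bounds on the right-hand side, on increments, and dissipation\<close>

lemma sum_w_delayed_le:
  assumes "t0 \<le> t" and "\<And>s. s \<in> {t - r..t} \<Longrightarrow> \<bar>x s - K\<bar> \<le> U"
  shows "\<bar>\<Sum>j=1..m. w j * (x (t - \<tau> j t) - K)\<bar> \<le> \<delta> * U"
proof -
  have "\<bar>\<Sum>j=1..m. w j * (x (t - \<tau> j t) - K)\<bar> \<le> (\<Sum>j=1..m. w j * U)"
  proof (rule order_trans[OF sum_abs], rule sum_mono)
    fix j assume j: "j \<in> {1..m}"
    have "\<bar>x (t - \<tau> j t) - K\<bar> \<le> U" using \<tau>_range[OF j assms(1)] by (intro assms(2)) auto
    then show "\<bar>w j * (x (t - \<tau> j t) - K)\<bar> \<le> w j * U"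
      unfolding abs_mult using w_pos[OF j] by simp
  qed
  then show ?thesis by (simp only: sum_distrib_right[symmetric] sum_w)
qed

text \<open>The crude bound, with no cancellation used: the \<tau>-delayed sum and the instantaneous
  term cost \<open>\<delta>\<close> each, the \<sigma>-delayed sum costs \<open>K * A\<close>, the
  remainder \<open>h\<close>. This is the origin of the denominator
  \<open>2 * \<delta> + K * A\<close> in the stability condition.\<close>

lemma abs_rhs_le:
  assumes rad: "linearization_radius h \<eta>" and t: "t0 \<le> t"
    and U: "\<And>s. s \<in> {t - r..t} \<Longrightarrow> \<bar>x s - K\<bar> \<le> U"
    and small: "\<And>s. s \<in> {t - r..t} \<Longrightarrow> \<bar>x s - K\<bar> < \<eta>"
  shows "\<bar>rhs x t\<bar> \<le> (2 * \<delta> + K * A + h) * U"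
proof -
  let ?S\<tau> = "\<Sum>j=1..m. w j * (x (t - \<tau> j t) - K)"
  let ?S\<sigma> = "\<Sum>j=1..m. a j * w j * (x (t - \<sigma> j t) - K)"
  have "\<bar>rhs x t - (?S\<tau> - K * ?S\<sigma> - \<delta> * (x t - K))\<bar> \<le> h * U"
    using rad t U small unfolding linearization_radius_def by blast
  moreover have "\<bar>?S\<tau>\<bar> \<le> \<delta> * U" by (rule sum_w_delayed_le[OF t U])
  moreover have "\<bar>K * ?S\<sigma>\<bar> \<le> K * (A * U)"
  proof -
    have "\<bar>?S\<sigma>\<bar> \<le> (\<Sum>j=1..m. a j * w j * U)"
    proof (rule order_trans[OF sum_abs], rule sum_mono)
      fix j assume j: "j \<in> {1..m}"
      have "\<bar>x (t - \<sigma> j t) - K\<bar> \<le> U" using \<sigma>_range[OF j t] by (intro U) auto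
      then show "\<bar>a j * w j * (x (t - \<sigma> j t) - K)\<bar> \<le> a j * w j * U"
        unfolding abs_mult using w_pos[OF j] a_pos[OF j] by simp
    qed
    also have "\<dots> = A * U" by (simp only: sum_distrib_right[symmetric] A_def)
    finally show ?thesis unfolding abs_mult using K_pos by simp
  qed
  moreover have "\<bar>\<delta> * (x t - K)\<bar> \<le> \<delta> * U"
    unfolding abs_mult using U[of t] r_nonneg \<delta>_pos by simp
  ultimately show ?thesis unfolding abs_le_iff by (auto simp: algebra_simps)
qed

lemma integrable_\<beta>: "t0 \<le> s \<Longrightarrow> \<beta> integrable_on {s..t}"
  by (rule integrable_continuous_interval, rule continuous_on_subset[OF \<beta>_cont]) auto

text \<open>Integrates the crude bound. The window begins at \<open>s - r\<close> because
  \<open>rhs x u\<close> looks back as far as \<open>u - r\<close> for every \<open>u\<close> in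
  \<open>{s..t}\<close>.\<close>

lemma increment_le:
  assumes rad: "linearization_radius h \<eta>" and s: "t0 \<le> s" "s \<le> t"
    and deriv: "\<And>u. t0 \<le> u \<Longrightarrow> (x has_real_derivative \<beta> u * rhs x u) (at u within {t0..})"
    and U: "\<And>u. u \<in> {s - r..t} \<Longrightarrow> \<bar>x u - K\<bar> \<le> U"
    and small: "\<And>u. u \<in> {s - r..t} \<Longrightarrow> \<bar>x u - K\<bar> < \<eta>"
  shows "\<bar>x t - x s\<bar> \<le> integral {s..t} \<beta> * ((2 * \<delta> + K * A + h) * U)"
proof -
  have int: "((\<lambda>u. \<beta> u * rhs x u) has_integral (x t - x s)) {s..t}"
  proof (rule fundamental_theorem_of_calculus[OF s(2)])
    fix u assume "u \<in> {s..t}"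
    then have "(x has_real_derivative \<beta> u * rhs x u) (at u within {s..t})"
      using s by (intro DERIV_subset[OF deriv]) auto
    then show "(x has_vector_derivative \<beta> u * rhs x u) (at u within {s..t})"
      by (simp add: has_real_derivative_iff_has_vector_derivative)
  qed
  have "norm (integral {s..t} (\<lambda>u. \<beta> u * rhs x u))
      \<le> integral {s..t} (\<lambda>u. \<beta> u * ((2 * \<delta> + K * A + h) * U))"
  proof (rule integral_norm_bound_integral)
    show "(\<lambda>u. \<beta> u * rhs x u) integrable_on {s..t}" using int by (rule has_integral_integrable)
    show "(\<lambda>u. \<beta> u * ((2 * \<delta> + K * A + h) * U)) integrable_on {s..t}"
      by (rule integrable_on_mult_left[OF integrable_\<beta>[OF s(1)]])
    fix u assume u: "u \<in> {s..t}"
    have "\<bar>rhs x u\<bar> \<le> (2 * \<delta> + K * A + h) * U"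
      using u s by (intro abs_rhs_le[OF rad] U small) auto
    then show "norm (\<beta> u * rhs x u) \<le> \<beta> u * ((2 * \<delta> + K * A + h) * U)"
      unfolding real_norm_def abs_mult using \<beta>_nonneg[of u] u s by (simp add: mult_left_mono)
  qed
  then show ?thesis using integral_unique[OF int] by simp
qed

text \<open>Here \<open>E\<close> measures how much larger than its current value \<open>V\<close> the deviation may have been
  during the last \<open>2 r\<close> time units.\<close>

lemma dissipation:
  assumes rad: "linearization_radius h \<eta>" and h: "0 \<le> h" and t: "t0 + r \<le> t"
    and deriv: "\<And>u. t0 \<le> u \<Longrightarrow> (x has_real_derivative \<beta> u * rhs x u) (at u within {t0..})"
    and U: "\<And>u. u \<in> {t - 2 * r..t} \<Longrightarrow> \<bar>x u - K\<bar> \<le> E * V"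
    and small: "\<And>u. u \<in> {t - 2 * r..t} \<Longrightarrow> \<bar>x u - K\<bar> < \<eta>"
    and V: "\<bar>x t - K\<bar> = V"
    and q: "(\<Sum>j=1..m. a j * w j * integral {t - \<sigma> j t..t} \<beta>) \<le> q"
  shows "(x t - K) * rhs x t
    \<le> - ((\<delta> + K * A) - (\<delta> + h + K * q * (2 * \<delta> + K * A + h)) * E) * V\<^sup>2"
proof -
  define G where "G = 2 * \<delta> + K * A + h"
  let ?S\<tau> = "\<Sum>j=1..m. w j * (x (t - \<tau> j t) - K)"
  let ?S\<sigma> = "\<Sum>j=1..m. a j * w j * (x (t - \<sigma> j t) - K)"
  let ?D = "\<Sum>j=1..m. a j * w j * (x t - x (t - \<sigma> j t))"
  define Rem where "Rem = rhs x t - (?S\<tau> - K * ?S\<sigma> - \<delta> * (x t - K))"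
  have G: "0 \<le> G" using h \<delta>_pos K_pos A_nonneg by (simp add: G_def)
  have t': "t0 \<le> t" using t r_nonneg by simp
  have EV: "0 \<le> E * V" using U[of t] r_nonneg V by auto
  have "\<bar>Rem\<bar> \<le> h * (E * V)"
    using rad t' U small r_nonneg unfolding linearization_radius_def Rem_def by auto
  moreover have "\<bar>?S\<tau>\<bar> \<le> \<delta> * (E * V)"
    using r_nonneg by (intro sum_w_delayed_le[OF t'] U) auto
  moreover have "\<bar>K * ?D\<bar> \<le> K * (q * (G * (E * V)))"
  proof -
    have "\<bar>?D\<bar> \<le> (\<Sum>j=1..m. a j * w j * integral {t - \<sigma> j t..t} \<beta> * (G * (E * V)))"
    proof (rule order_trans[OF sum_abs], rule sum_mono)
      fix j assume j: "j \<in> {1..m}"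
      \<comment> \<open>The increment reaches back to \<open>t - \<sigma> j t\<close>, and the
        equation there looks back by up to another \<open>r\<close>: hence the window of length
        \<open>2 * r\<close>. The condition \<open>t0 + r \<le> t\<close> keeps the integration
        interval above \<open>t0\<close>.\<close>
      have "\<bar>x t - x (t - \<sigma> j t)\<bar> \<le> integral {t - \<sigma> j t..t} \<beta> * (G * (E * V))"
        unfolding G_def using \<sigma>_range[OF j t'] t r_nonneg
        by (intro increment_le[OF rad _ _ deriv] U small) auto
      then show "\<bar>a j * w j * (x t - x (t - \<sigma> j t))\<bar>
          \<le> a j * w j * integral {t - \<sigma> j t..t} \<beta> * (G * (E * V))"
        unfolding abs_mult using w_pos[OF j] a_pos[OF j] by (simp add: mult.assoc)
    qed
    also have "\<dots> = (\<Sum>j=1..m. a j * w j * integral {t - \<sigma> j t..t} \<beta>) * (G * (E * V))"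
      by (rule sum_distrib_right[symmetric])
    also have "\<dots> \<le> q * (G * (E * V))" using q G EV by (intro mult_right_mono) auto
    finally show ?thesis unfolding abs_mult using K_pos by simp
  qed
  ultimately have "\<bar>Rem + ?S\<tau> + K * ?D\<bar> \<le> (\<delta> + h + K * q * G) * (E * V)"
    unfolding abs_le_iff by (auto simp: algebra_simps)
  then have le: "(x t - K) * (Rem + ?S\<tau> + K * ?D) \<le> V * ((\<delta> + h + K * q * G) * (E * V))"
    using V abs_ge_self[of "(x t - K) * (Rem + ?S\<tau> + K * ?D)"] unfolding abs_mult
    by (meson abs_ge_zero mult_left_mono order_trans)
  \<comment> \<open>Replacing the \<sigma>-delayed sum by its instantaneous value minus increments
    adds \<open>K * A\<close> to the damping coefficient \<open>\<delta>\<close>.\<close>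
  have "?D = A * (x t - K) - ?S\<sigma>"
    unfolding A_def sum_distrib_right sum_subtractf[symmetric]
    by (intro sum.cong refl) (simp add: algebra_simps)
  then have "rhs x t = - (\<delta> + K * A) * (x t - K) + (Rem + ?S\<tau> + K * ?D)"
    unfolding Rem_def by algebra
  then have "(x t - K) * rhs x t
      = - (\<delta> + K * A) * (x t - K)\<^sup>2 + (x t - K) * (Rem + ?S\<tau> + K * ?D)"
    by (simp only: power2_eq_square distrib_left mult_ac)
  also have "(x t - K)\<^sup>2 = V\<^sup>2" unfolding V[symmetric] by simp
  also have "- (\<delta> + K * A) * V\<^sup>2 + (x t - K) * (Rem + ?S\<tau> + K * ?D)
      \<le> - (\<delta> + K * A) * V\<^sup>2 + V * ((\<delta> + h + K * q * G) * (E * V))"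
    by (rule add_left_mono[OF le])
  also have "\<dots> = - ((\<delta> + K * A) - (\<delta> + h + K * q * G) * E) * V\<^sup>2"
    by (simp add: power2_eq_square algebra_simps)
  finally show ?thesis unfolding G_def .
qed

section \<open>Decay rate and the two exponential barriers\<close>

text \<open>At \<open>h = 0\<close> the right-hand side is
  \<open>b * K * (A - q * (2 * \<delta> + K * A))\<close>, which is positive; continuity yields a
  small positive \<open>h\<close>. The same \<open>h\<close> serves as remainder constant, as decay
  rate and in the exponent of the history factor.\<close>

lemma dissipation_rate:
  assumes "0 < b" and "q * (2 * \<delta> + K * A) < A"
  obtains h where "0 < h"
    and "h < b * ((\<delta> + K * A) - (\<delta> + h + K * q * (2 * \<delta> + K * A + h)) * exp (h * (2 * r)))"
proof -
  define F where
    "F h = b * ((\<delta> + K * A) - (\<delta> + h + K * q * (2 * \<delta> + K * A + h)) * exp (h * (2 * r))) - h" for h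
  have "K * (q * (2 * \<delta> + K * A)) < K * A" using assms(2) K_pos by simp
  then have "0 < F 0" using assms(1) by (simp add: F_def mult.assoc)
  moreover have "(F \<longlongrightarrow> F 0) (at_right 0)"
    unfolding F_def by (intro tendsto_intros)
  ultimately have "\<forall>\<^sub>F h in at_right 0. 0 < F h" by (rule order_tendstoD(1)[rotated])
  moreover have "\<forall>\<^sub>F h in at_right (0::real). 0 < h" by (rule eventually_at_right_less)
  ultimately have "\<forall>\<^sub>F h in at_right 0. 0 < h \<and> 0 < F h" by eventually_elim simp
  then obtain h where "0 < h" "0 < F h" using eventually_happens'[OF trivial_limit_at_right_real] by blast
  then show thesis by (intro that[of h]) (auto simp: F_def)
qed

text \<open>The barrier increases, so its current value also bounds the whole past, including the
  initial history. The crude bound gives growth rate at most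
  \<open>B * (2 * \<delta> + K * A + h)\<close>, and the extra \<open>1\<close> in
  \<open>\<Lambda>\<close> makes the comparison strict. The barrier stays below
  \<open>\<eta>\<close> up to \<open>T\<close>, so the linearization remains valid.\<close>

lemma growth_on_initial_interval:
  assumes rad: "linearization_radius h \<eta>" and h: "0 \<le> h"
    and \<beta>_le: "\<And>t. t0 \<le> t \<Longrightarrow> \<beta> t \<le> B"
    and deriv: "\<And>u. t0 \<le> u \<Longrightarrow> (x has_real_derivative \<beta> u * rhs x u) (at u within {t0..})"
    and hist: "\<And>s. s \<in> {t0 - r..t0} \<Longrightarrow> \<bar>x s - K\<bar> < D"
    and \<Lambda>: "\<Lambda> = B * (2 * \<delta> + K * A + h) + 1"
    and small: "exp (\<Lambda> * (T - t0)) * D < \<eta>"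
    and t: "t \<in> {t0..T}"
  shows "\<bar>x t - K\<bar> < exp (\<Lambda> * (t - t0)) * D"
proof -
  define G where "G = 2 * \<delta> + K * A + h"
  have G: "0 \<le> G" using h \<delta>_pos K_pos A_nonneg by (simp add: G_def)
  have B: "0 \<le> B" using \<beta>_nonneg[of t0] \<beta>_le[of t0] by simp
  have "0 < \<Lambda>" using B G \<Lambda> by (simp add: G_def[symmetric] add_nonneg_pos)
  have "0 < D" using hist[of t0] r_nonneg by auto
  show ?thesis
  proof (rule abs_less_by_derivative_comparison[where T = t0 and S = T and y = "\<lambda>t. x t - K"
        and V = "\<lambda>t. exp (\<Lambda> * (t - t0)) * D"
        and y' = "\<lambda>t. \<beta> t * rhs x t" and V' = "\<lambda>t. \<Lambda> * (exp (\<Lambda> * (t - t0)) * D)"])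
    show "((\<lambda>t. x t - K) has_real_derivative \<beta> u * rhs x u) (at u within {t0..T})"
      if "u \<in> {t0..T}" for u
    proof -
      have "(x has_real_derivative \<beta> u * rhs x u) (at u within {t0..T})"
        using that by (intro DERIV_subset[OF deriv]) auto
      then show ?thesis by (auto intro!: derivative_eq_intros)
    qed
    show "((\<lambda>t. exp (\<Lambda> * (t - t0)) * D) has_real_derivative \<Lambda> * (exp (\<Lambda> * (u - t0)) * D))
        (at u within {t0..T})" for u
      by (auto intro!: derivative_eq_intros)
    show "0 < exp (\<Lambda> * (u - t0)) * D" for u using \<open>0 < D\<close> by simp
    show "\<bar>x t0 - K\<bar> < exp (\<Lambda> * (t0 - t0)) * D" using hist[of t0] r_nonneg by simp
    show "t \<in> {t0..T}" by (rule t)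
  next
    fix u
    define V where "V = exp (\<Lambda> * (u - t0)) * D"
    assume u: "u \<in> {t0..T}" and le: "\<forall>s\<in>{t0..u}. \<bar>x s - K\<bar> \<le> exp (\<Lambda> * (s - t0)) * D"
      and "\<bar>x u - K\<bar> = exp (\<Lambda> * (u - t0)) * D"
    then have eq: "\<bar>x u - K\<bar> = V" by (simp add: V_def)
    have "0 < V" using \<open>0 < D\<close> by (simp add: V_def)
    have past: "\<bar>x s - K\<bar> \<le> V" if "s \<in> {t0 - r..u}" for s
    proof (cases "s \<le> t0")
      case True
      have "1 * D \<le> V" unfolding V_def using \<open>0 < D\<close> \<open>0 < \<Lambda>\<close> u by (intro mult_right_mono) auto
      then show ?thesis using hist[of s] True that by auto
    next
      case False
      then have "exp (\<Lambda> * (s - t0)) * D \<le> V"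
        unfolding V_def using \<open>0 < D\<close> \<open>0 < \<Lambda>\<close> that by simp
      moreover have "\<bar>x s - K\<bar> \<le> exp (\<Lambda> * (s - t0)) * D" using le False that by auto
      ultimately show ?thesis by linarith
    qed
    have "V \<le> exp (\<Lambda> * (T - t0)) * D"
      unfolding V_def using \<open>0 < D\<close> \<open>0 < \<Lambda>\<close> u by simp
    then have "V < \<eta>" using small by simp
    have "\<bar>rhs x u\<bar> \<le> G * V"
      unfolding G_def using u past \<open>V < \<eta>\<close>
      by (intro abs_rhs_le[OF rad] past le_less_trans[OF past]) auto
    then have "\<bar>\<beta> u * rhs x u\<bar> \<le> B * (G * V)"
      unfolding abs_mult using \<beta>_nonneg[of u] \<beta>_le[of u] u B by (intro mult_mono) auto
    then have "(x u - K) * (\<beta> u * rhs x u) \<le> V * (B * (G * V))"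
      using eq \<open>0 < V\<close> abs_ge_self[of "(x u - K) * (\<beta> u * rhs x u)"] unfolding abs_mult[of "x u - K"]
      by (meson less_imp_le mult_left_mono order_trans)
    also have "\<dots> < V * (\<Lambda> * V)"
      using \<open>0 < V\<close> unfolding \<Lambda> G_def[symmetric] by (simp add: algebra_simps)
    finally show "(x u - K) * (\<beta> u * rhs x u)
        < exp (\<Lambda> * (u - t0)) * D * (\<Lambda> * (exp (\<Lambda> * (u - t0)) * D))"
      by (simp add: V_def)
  qed
qed

text \<open>Looking back by \<open>2 * r\<close> raises the barrier by a factor of at most
  \<open>exp (h * (2 * r))\<close>, which is the \<open>E\<close> of \<open>dissipation\<close>. At
  a contact the dissipation is then stronger than the slope \<open>- h\<close> of the
  barrier.\<close>

lemma decay: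
  assumes rad: "linearization_radius h \<eta>" and h: "0 < h" and T: "t0 + r \<le> T"
    and b: "0 < b" "\<And>t. t0 \<le> t \<Longrightarrow> b \<le> \<beta> t"
    and rate: "h < b * ((\<delta> + K * A) - (\<delta> + h + K * q * (2 * \<delta> + K * A + h)) * exp (h * (2 * r)))"
    and q: "\<And>t. T \<le> t \<Longrightarrow> (\<Sum>j=1..m. a j * w j * integral {t - \<sigma> j t..t} \<beta>) \<le> q"
    and deriv: "\<And>u. t0 \<le> u \<Longrightarrow> (x has_real_derivative \<beta> u * rhs x u) (at u within {t0..})"
    and hist: "\<And>s. s \<in> {t0 - r..T} \<Longrightarrow> \<bar>x s - K\<bar> < D"
    and small: "D < \<eta>"
    and t: "T \<le> t"
  shows "\<bar>x t - K\<bar> < exp (- h * (t - T)) * D"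
proof -
  define \<kappa> where "\<kappa> = (\<delta> + K * A) - (\<delta> + h + K * q * (2 * \<delta> + K * A + h)) * exp (h * (2 * r))"
  \<comment> \<open>Positivity of \<open>\<kappa>\<close> is what later allows
    \<open>\<beta> u\<close> to be replaced by its lower bound \<open>b\<close> in a negative
    term.\<close>
  have "0 < b * \<kappa>" using rate h by (simp add: \<kappa>_def)
  then have "0 < \<kappa>" using b(1) by (simp add: zero_less_mult_iff)
  have "0 < D" using hist[of T] r_nonneg T by auto
  show ?thesis
  proof (rule abs_less_by_derivative_comparison[where T = T and S = t and y = "\<lambda>t. x t - K"
        and V = "\<lambda>t. exp (- h * (t - T)) * D"
        and y' = "\<lambda>t. \<beta> t * rhs x t" and V' = "\<lambda>t. - h * (exp (- h * (t - T)) * D)"])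
    show "((\<lambda>t. x t - K) has_real_derivative \<beta> u * rhs x u) (at u within {T..t})"
      if "u \<in> {T..t}" for u
    proof -
      have "(x has_real_derivative \<beta> u * rhs x u) (at u within {T..t})"
        using that T r_nonneg by (intro DERIV_subset[OF deriv]) auto
      then show ?thesis by (auto intro!: derivative_eq_intros)
    qed
    show "((\<lambda>t. exp (- h * (t - T)) * D) has_real_derivative - h * (exp (- h * (u - T)) * D))
        (at u within {T..t})" for u
      by (auto intro!: derivative_eq_intros)
    show "0 < exp (- h * (u - T)) * D" for u using \<open>0 < D\<close> by simp
    show "\<bar>x T - K\<bar> < exp (- h * (T - T)) * D" using hist[of T] r_nonneg T by simp
    show "t \<in> {T..t}" using t by simp
  next
    fix u
    define V where "V = exp (- h * (u - T)) * D"
    assume u: "u \<in> {T..t}" and le: "\<forall>s\<in>{T..u}. \<bar>x s - K\<bar> \<le> exp (- h * (s - T)) * D"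
      and "\<bar>x u - K\<bar> = exp (- h * (u - T)) * D"
    then have eq: "\<bar>x u - K\<bar> = V" by (simp add: V_def)
    have "0 < V" using \<open>0 < D\<close> by (simp add: V_def)
    have EV: "exp (h * (2 * r)) * V = exp (h * (2 * r - (u - T))) * D"
    proof -
      have "exp (h * (2 * r)) * exp (- h * (u - T)) = exp (h * (2 * r - (u - T)))"
        unfolding exp_add[symmetric] by (simp add: algebra_simps)
      then show ?thesis by (simp add: V_def flip: mult.assoc)
    qed
    have past: "\<bar>x s - K\<bar> \<le> exp (h * (2 * r)) * V" "\<bar>x s - K\<bar> < \<eta>" if s: "s \<in> {u - 2 * r..u}" for s
    proof -
      have "\<bar>x s - K\<bar> \<le> exp (h * (2 * r)) * V \<and> \<bar>x s - K\<bar> \<le> D"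
      proof (cases "s \<le> T")
        case True
        then have "\<bar>x s - K\<bar> \<le> D" using hist[of s] s u T by auto
        \<comment> \<open>Before \<open>T\<close> only the constant bound \<open>D\<close> is known;
          since \<open>u - 2 * r \<le> s \<le> T\<close>, the barrier has decayed for at most
          \<open>2 * r\<close> time units.\<close>
        moreover have "1 * D \<le> exp (h * (2 * r)) * V"
          unfolding EV using \<open>0 < D\<close> h s True by (intro mult_right_mono) auto
        ultimately show ?thesis by simp
      next
        case False
        have "exp (- h * (s - T)) \<le> exp (h * (2 * r - (u - T)))"
        proof -
          have "h * (T - s) \<le> h * (2 * r - (u - T))" using h s by (intro mult_left_mono) auto
          then show ?thesis by (simp add: algebra_simps)
        qed
        then have "exp (- h * (s - T)) * D \<le> exp (h * (2 * r)) * V"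
          unfolding EV using \<open>0 < D\<close> by simp
        moreover have "exp (- h * (s - T)) * D \<le> 1 * D"
          using h False \<open>0 < D\<close> by (intro mult_right_mono) auto
        moreover have "\<bar>x s - K\<bar> \<le> exp (- h * (s - T)) * D" using le False s by auto
        ultimately show ?thesis by linarith
      qed
      then show "\<bar>x s - K\<bar> \<le> exp (h * (2 * r)) * V" "\<bar>x s - K\<bar> < \<eta>" using small by auto
    qed
    have "(x u - K) * rhs x u \<le> - \<kappa> * V\<^sup>2"
      unfolding \<kappa>_def using u T h past q
      by (intro dissipation[OF rad _ _ deriv _ _ eq]) auto
    moreover have "t0 \<le> u" using u T r_nonneg by simp
    ultimately have "\<beta> u * ((x u - K) * rhs x u) \<le> \<beta> u * (- \<kappa> * V\<^sup>2)"
      using \<beta>_nonneg by (intro mult_left_mono) auto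
    also have "\<dots> \<le> b * (- \<kappa> * V\<^sup>2)"
      using b(2)[OF \<open>t0 \<le> u\<close>] \<open>0 < \<kappa>\<close> by (simp add: mult_right_mono)
    also have "\<dots> < V * (- h * V)"
      using rate \<open>0 < V\<close> unfolding \<kappa>_def[symmetric] by (simp add: power2_eq_square)
    finally show "(x u - K) * (\<beta> u * rhs x u)
        < exp (- h * (u - T)) * D * (- h * (exp (- h * (u - T)) * D))"
      by (simp add: V_def mult_ac)
  qed
qed

section \<open>Local exponential stability\<close>

text \<open>Growth by at most the factor \<open>C\<close> up to the time \<open>T\<close> from which
  the bound \<open>q\<close> holds, followed by decay at rate \<open>h\<close>. All constants are
  fixed before the initial function.\<close>

lemma locally_exp_stable_equilibrium:
  assumes b: "0 < b" "\<And>t. t0 \<le> t \<Longrightarrow> b \<le> \<beta> t"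
    and B: "\<And>t. t0 \<le> t \<Longrightarrow> \<beta> t \<le> B"
    and q: "\<forall>\<^sub>F t in at_top. (\<Sum>j=1..m. a j * w j * integral {t - \<sigma> j t..t} \<beta>) \<le> q"
    and qA: "q * (2 * \<delta> + K * A) < A"
  shows "locally_exp_stable t0 r (nicholson_solution t0 r m p a \<delta> \<beta> \<tau> \<sigma>) K"
proof -
  obtain h where h: "0 < h"
    "h < b * ((\<delta> + K * A) - (\<delta> + h + K * q * (2 * \<delta> + K * A + h)) * exp (h * (2 * r)))"
    by (rule dissipation_rate[OF b(1) qA])
  obtain \<eta> where "0 < \<eta>" and rad: "linearization_radius h \<eta>" by (rule small_remainder[OF h(1)])
  obtain N where N: "\<And>t. N \<le> t \<Longrightarrow> (\<Sum>j=1..m. a j * w j * integral {t - \<sigma> j t..t} \<beta>) \<le> q"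
    using q unfolding eventually_at_top_linorder by blast
  define T where "T = max N (t0 + r)"
  have T: "t0 + r \<le> T" "t0 \<le> T" "N \<le> T" using r_nonneg by (auto simp: T_def)
  define \<Lambda> where "\<Lambda> = B * (2 * \<delta> + K * A + h) + 1"
  have "0 \<le> B" using b(2)[of t0] b(1) B[of t0] by simp
  then have \<Lambda>: "0 \<le> \<Lambda>" using h \<delta>_pos K_pos A_nonneg by (simp add: \<Lambda>_def)
  define C where "C = exp (\<Lambda> * (T - t0))"
  have C: "1 \<le> C" using T \<Lambda> by (simp add: C_def)
  \<comment> \<open>The exponential factor compensates for decay being counted from
    \<open>t0\<close> although it is only guaranteed from \<open>T\<close> on.\<close>
  define M where "M = C * exp (h * (T - t0))"
  show ?thesis
    unfolding locally_exp_stable_def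
  proof (intro exI conjI ballI impI allI)
    \<comment> \<open>The radius \<open>\<eta> / C\<close> keeps the deviation below
      \<open>\<eta>\<close> even after growth by \<open>C\<close>.\<close>
    show "0 < \<eta> / C" "0 < M" "0 < h" using \<open>0 < \<eta>\<close> C h by (auto simp: M_def)
    fix \<phi> x t
    define D where "D = phase_norm r (\<lambda>\<theta>. \<phi> \<theta> - K)"
    assume adm: "\<phi> \<in> admissible r" and small: "phase_norm r (\<lambda>\<theta>. \<phi> \<theta> - K) < \<eta> / C"
      and sol: "nicholson_solution t0 r m p a \<delta> \<beta> \<tau> \<sigma> \<phi> x" and t: "t0 \<le> t"
    have deriv: "(x has_real_derivative \<beta> u * rhs x u) (at u within {t0..})" if "t0 \<le> u" for u
      using sol that unfolding nicholson_solution_def rhs_def by blast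
    have "continuous_on {- r..0} (\<lambda>\<theta>. \<bar>\<phi> \<theta> - K\<bar>)"
      using adm unfolding admissible_def phase_space_def by (intro continuous_intros) simp
    then have "bdd_above ((\<lambda>\<theta>. \<bar>\<phi> \<theta> - K\<bar>) ` {- r..0})"
      by (intro bounded_imp_bdd_above compact_imp_bounded compact_continuous_image) auto
    then have \<phi>_le: "\<bar>\<phi> \<theta> - K\<bar> \<le> D" if "\<theta> \<in> {- r..0}" for \<theta>
      unfolding D_def phase_norm_def using that by (rule cSUP_upper2) simp_all
    have hist: "\<bar>x s - K\<bar> \<le> D" if "s \<in> {t0 - r..t0}" for s
    proof -
      have "s - t0 \<in> {- r..0}" using that by simp
      then have "x (t0 + (s - t0)) = \<phi> (s - t0)"
        using sol unfolding nicholson_solution_def by blast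
      then show ?thesis using \<phi>_le[of "s - t0"] that by simp
    qed
    \<comment> \<open>The barriers need a strict inequality at the start, so \<open>D\<close> is
      enlarged to \<open>D'\<close>; this also covers \<open>D = 0\<close>. Density of the reals
      then brings the bound back to \<open>D\<close>.\<close>
    have "\<bar>x t - K\<bar> \<le> M * exp (- h * (t - t0)) * D'" if D': "D < D'" "D' < \<eta> / C" for D'
    proof -
      have "0 < D'" using hist[of t0] r_nonneg D' by auto
      have CD: "C * D' < \<eta>" using D' C by (simp add: field_simps)
      have start: "\<bar>x s - K\<bar> < D'" if "s \<in> {t0 - r..t0}" for s using hist[OF that] D' by simp
      have grow: "\<bar>x s - K\<bar> < C * D'" if s: "s \<in> {t0 - r..T}" for s
      proof (cases "s \<le> t0")
        case True
        have "1 * D' \<le> C * D'" using C \<open>0 < D'\<close> by (intro mult_right_mono) auto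
        then show ?thesis using start[of s] s True by simp
      next
        case False
        have "\<bar>x s - K\<bar> < exp (\<Lambda> * (s - t0)) * D'"
          using h s False CD
          by (intro growth_on_initial_interval[OF rad _ B deriv start \<Lambda>_def]) (auto simp: C_def)
        also have "\<dots> \<le> C * D'"
          unfolding C_def using \<open>0 < D'\<close> \<Lambda> s by (simp add: mult_left_mono)
        finally show ?thesis .
      qed
      have M: "M * exp (- h * (t - t0)) * D' = exp (- h * (t - T)) * (C * D')"
      proof -
        have "exp (h * (T - t0)) * exp (- h * (t - t0)) = exp (- h * (t - T))"
          unfolding exp_add[symmetric] by (simp add: algebra_simps)
        then show ?thesis by (simp add: M_def mult_ac flip: exp_add)
      qed
      show ?thesis
      proof (cases "t \<le> T")
        case True
        have "1 * (C * D') \<le> exp (- h * (t - T)) * (C * D')"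
          using True h C \<open>0 < D'\<close> by (intro mult_right_mono) (auto simp: mult_nonneg_nonpos)
        then show ?thesis unfolding M using grow[of t] t True r_nonneg by simp
      next
        case False
        then have "\<bar>x t - K\<bar> < exp (- h * (t - T)) * (C * D')"
          using T N by (intro decay[OF rad h(1) T(1) b h(2) _ deriv grow CD]) auto
        then show ?thesis unfolding M by simp
      qed
    qed
    moreover have pos: "0 < M * exp (- h * (t - t0))" using C by (simp add: M_def)
    ultimately have "\<bar>x t - K\<bar> / (M * exp (- h * (t - t0))) \<le> D'" if "D < D'" "D' < \<eta> / C" for D'
      using that by (simp add: divide_le_eq mult.commute)
    then have "\<bar>x t - K\<bar> / (M * exp (- h * (t - t0))) \<le> D"
      using small unfolding D_def[symmetric] by (rule dense_ge_bounded[rotated])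
    then show "\<bar>x t - K\<bar> \<le> M * exp (- h * (t - t0)) * phase_norm r (\<lambda>\<theta>. \<phi> \<theta> - K)"
      unfolding D_def[symmetric] using pos by (simp add: divide_le_eq mult.commute)
  qed
qed

end

section \<open>Passage from the stated hypotheses to the locale\<close>

lemma max_delay_upper:
  assumes j: "j \<in> {1..m}" and t: "t0 \<le> t"
    and bdd: "bounded (\<tau> j ` {t0..})" "bounded (\<sigma> j ` {t0..})"
  shows "\<tau> j t \<le> max_delay t0 m \<tau> \<sigma>" "\<sigma> j t \<le> max_delay t0 m \<tau> \<sigma>"
proof -
  have le: "max (SUP t\<in>{t0..}. \<tau> j t) (SUP t\<in>{t0..}. \<sigma> j t) \<le> max_delay t0 m \<tau> \<sigma>"
    unfolding max_delay_def using j by (intro Max_ge) auto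
  have "\<tau> j t \<le> (SUP t\<in>{t0..}. \<tau> j t)" "\<sigma> j t \<le> (SUP t\<in>{t0..}. \<sigma> j t)"
    using t bdd by (auto intro!: cSUP_upper bounded_imp_bdd_above)
  then show "\<tau> j t \<le> max_delay t0 m \<tau> \<sigma>" "\<sigma> j t \<le> max_delay t0 m \<tau> \<sigma>"
    using le by linarith+
qed

theorem theorem2p2:
  fixes t0 \<delta> K :: real and m :: nat
    and p a :: "nat \<Rightarrow> real"
    and \<beta> :: "real \<Rightarrow> real"
    and \<tau> \<sigma> :: "nat \<Rightarrow> real \<Rightarrow> real"
  assumes "m \<ge> 1"
    and "\<delta> > 0"
    and "\<And>j. j \<in> {1..m} \<Longrightarrow> p j > 0"
    and "\<And>j. j \<in> {1..m} \<Longrightarrow> a j > 0"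
    and "continuous_on {t0..} \<beta>"
    and "bounded (\<beta> ` {t0..})"
    and "\<And>t. t \<ge> t0 \<Longrightarrow> \<beta> t \<ge> 0"
    and "(INF t\<in>{t0..}. \<beta> t) > 0"
    and "\<And>j. j \<in> {1..m} \<Longrightarrow> continuous_on {t0..} (\<tau> j)"
    and "\<And>j. j \<in> {1..m} \<Longrightarrow> bounded (\<tau> j ` {t0..})"
    and "\<And>j t. j \<in> {1..m} \<Longrightarrow> t \<ge> t0 \<Longrightarrow> \<tau> j t \<ge> 0"
    and "\<And>j. j \<in> {1..m} \<Longrightarrow> continuous_on {t0..} (\<sigma> j)"
    and "\<And>j. j \<in> {1..m} \<Longrightarrow> bounded (\<sigma> j ` {t0..})"
    and "\<And>j t. j \<in> {1..m} \<Longrightarrow> t \<ge> t0 \<Longrightarrow> \<sigma> j t \<ge> 0"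
    and "(\<Sum>j=1..m. p j) > \<delta>"
    and "K > 0"
    and "(\<Sum>j=1..m. p j * exp (- a j * K)) = \<delta>"
    and "Limsup at_top (\<lambda>t. ereal (\<Sum>j=1..m. a j * p j * exp (- a j * K) * integral {t - \<sigma> j t..t} \<beta>))
         < ereal ((\<Sum>j=1..m. a j * p j * exp (- a j * K)) /
                  (2 * \<delta> + K * (\<Sum>j=1..m. a j * p j * exp (- a j * K))))"
  shows "locally_exp_stable t0 (max_delay t0 m \<tau> \<sigma>)
           (nicholson_solution t0 (max_delay t0 m \<tau> \<sigma>) m p a \<delta> \<beta> \<tau> \<sigma>) K"
proof -
  let ?r = "max_delay t0 m \<tau> \<sigma>"
  have delays: "\<tau> j t \<le> ?r" "\<sigma> j t \<le> ?r" if "j \<in> {1..m}" "t0 \<le> t" for j t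
    using max_delay_upper[OF that] assms(10,13) that by blast+
  have "0 \<le> ?r" using assms(11)[of 1 t0] delays(1)[of 1 t0] \<open>m \<ge> 1\<close> by simp
  interpret nicholson_equilibrium t0 ?r \<delta> K m p a \<beta> \<tau> \<sigma>
    using assms delays \<open>0 \<le> ?r\<close> by unfold_locales auto
  have A_eq: "A = (\<Sum>j=1..m. a j * p j * exp (- a j * K))"
    unfolding A_def w_def by (simp add: mult.assoc)
  have bdd: "bdd_below (\<beta> ` {t0..})" "bdd_above (\<beta> ` {t0..})"
    using assms(6) by (auto intro: bounded_imp_bdd_below bounded_imp_bdd_above)
  \<comment> \<open>A real \<open>q\<close> strictly between the upper limit and the threshold turns
    the former into an eventual bound and leaves the margin
    \<open>q * (2 * \<delta> + K * A) < A\<close>.\<close>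
  from ereal_dense2[OF assms(18)] obtain q where
    q: "Limsup at_top (\<lambda>t. ereal (\<Sum>j=1..m. a j * p j * exp (- a j * K) * integral {t - \<sigma> j t..t} \<beta>))
        < ereal q" "ereal q < ereal (A / (2 * \<delta> + K * A))"
    unfolding A_eq by blast
  show ?thesis
  proof (rule locally_exp_stable_equilibrium)
    show "0 < (INF t\<in>{t0..}. \<beta> t)" by fact
    show "(INF t\<in>{t0..}. \<beta> t) \<le> \<beta> t" if "t0 \<le> t" for t
      using that bdd by (intro cINF_lower) auto
    show "\<beta> t \<le> (SUP t\<in>{t0..}. \<beta> t)" if "t0 \<le> t" for t
      using that bdd by (intro cSUP_upper) auto
    show "\<forall>\<^sub>F t in at_top. (\<Sum>j=1..m. a j * w j * integral {t - \<sigma> j t..t} \<beta>) \<le> q"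
      using Limsup_lessD[OF q(1)] by eventually_elim (simp add: w_def mult.assoc)
    have "0 < 2 * \<delta> + K * A" using \<delta>_pos K_pos A_nonneg by (simp add: add_pos_nonneg)
    then show "q * (2 * \<delta> + K * A) < A" using q(2) by (simp add: less_divide_eq)
  qed
qed

end
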